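(* Let $n\geq 3$ and $d>n/2$. Then the number of zero-sum-free $d$-tuples in $\mathbb{Z}_n^d$ is $\alpha_n^d=\phi(n)\binom{n-1}{d}$.
   Context: $\mathbb{Z}_n$ is the ring of integers modulo $n$. A vector $(v_1,\dots,v_d)\in\mathbb{Z}_n^d$ is zero-sum-free if there is no non-empty subset of its components whose sum is $0$ in $\mathbb{Z}_n$; $\alpha_n^d$ denotes the number of such vectors. $\phi$ is Euler's totient function. *)

theory Defs
  imports "HOL-Number_Theory.Number_Theory" "HOL-Library.FuncSet"
begin

text \<open>
  A vector of \<open>\<int>\<^sub>n\<^sup>d\<close> is an extensional function on the index set \<open>{1..d}\<close>. A ``subset of its
  components'' is given by a set of indices, so equal entries in different positions count as
  different components.
\<close>

definition zero_sum_free :: "nat \<Rightarrow> nat \<Rightarrow> (nat \<Rightarrow> int) \<Rightarrow> bool" where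
  "zero_sum_free n d v \<longleftrightarrow>
     \<not> (\<exists>I. I \<subseteq> {1..d} \<and> I \<noteq> {} \<and>
         finsum (residue_ring (int n)) v I = \<zero>\<^bsub>residue_ring (int n)\<^esub>)"

definition zero_sum_free_vectors :: "nat \<Rightarrow> nat \<Rightarrow> (nat \<Rightarrow> int) set" where
  "zero_sum_free_vectors n d =
     {v \<in> {1..d} \<rightarrow>\<^sub>E carrier (residue_ring (int n)). zero_sum_free n d v}"

definition zsf_count :: "nat \<Rightarrow> nat \<Rightarrow> nat" where
  "zsf_count n d = card (zero_sum_free_vectors n d)"

end

theory Submission
  imports Defs
begin

text \<open>
  By a theorem of Savchev and Chen, the zero-sum-free vectors of length \<open>d > n / 2\<close> are exactly
  the vectors \<open>(b x\<^sub>1, \<dots>, b x\<^sub>d)\<close> with \<open>b\<close> a unit modulo \<open>n\<close> and positive integers \<open>x\<^sub>i\<close> whose sum is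
  less than \<open>n\<close>. The pair \<open>(b, x)\<close> is unique, and there are \<open>binomial (n - 1) d\<close> choices of \<open>x\<close>.

  The structure theorem goes by induction on the number of entries, for families having fewer subset
  sums than twice their length (the empty sum counted). If removing some entry loses at least two
  subset sums, the remaining family still satisfies the bound; its subset sums form a progression
  \<open>0, b, \<dots>, S b\<close>, which the removed entry must extend. If every removal loses just one subset sum,
  then all entries are equal.
\<close>

section \<open>Subset sums of zero-sum-free families\<close>

definition subset_sums :: "nat \<Rightarrow> ('i \<Rightarrow> int) \<Rightarrow> 'i set \<Rightarrow> int set" where
  "subset_sums n v I = (\<lambda>T. sum v T mod int n) ` Pow I"

text \<open>The index set is arbitrary so that the induction can drop entries.\<close>

definition zsf_on :: "nat \<Rightarrow> ('i \<Rightarrow> int) \<Rightarrow> 'i set \<Rightarrow> bool" where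
  "zsf_on n v I \<longleftrightarrow> (\<forall>T\<subseteq>I. T \<noteq> {} \<longrightarrow> \<not> int n dvd sum v T)"

lemma zsf_onD: "zsf_on n v I \<Longrightarrow> T \<subseteq> I \<Longrightarrow> T \<noteq> {} \<Longrightarrow> \<not> int n dvd sum v T"
  by (auto simp: zsf_on_def)

lemma zsf_on_subset: "zsf_on n v I \<Longrightarrow> J \<subseteq> I \<Longrightarrow> zsf_on n v J"
  by (auto simp: zsf_on_def)

lemma mod_in_subset_sums_iff:
  "z mod int n \<in> subset_sums n v I \<longleftrightarrow> (\<exists>T\<subseteq>I. [z = sum v T] (mod int n))"
  by (auto simp: subset_sums_def cong_def image_iff)

lemma finite_subset_sums: "finite I \<Longrightarrow> finite (subset_sums n v I)"
  by (simp add: subset_sums_def)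

lemma subset_sums_mono: "J \<subseteq> I \<Longrightarrow> subset_sums n v J \<subseteq> subset_sums n v I"
  by (auto simp: subset_sums_def)

lemma subset_sums_mod: "z \<in> subset_sums n v I \<Longrightarrow> z mod int n = z"
  by (auto simp: subset_sums_def)

lemma zero_in_subset_sums: "0 \<in> subset_sums n v I"
  unfolding subset_sums_def by (rule image_eqI[of _ _ "{}"]) auto

text \<open>Pass from \<open>T\<close> to its complement \<open>I - T\<close>.\<close>

lemma subset_sums_reflect:
  assumes "finite I" "z mod int n \<in> subset_sums n v I"
  shows "(sum v I - z) mod int n \<in> subset_sums n v I"
proof -
  obtain T where T: "T \<subseteq> I" "[z = sum v T] (mod int n)"
    using assms(2) by (auto simp: mod_in_subset_sums_iff)
  have "sum v (I - T) = sum v I - sum v T"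
    using T(1) assms(1) by (simp add: sum_diff)
  with T have "[sum v I - z = sum v (I - T)] (mod int n)"
    by (simp add: cong_diff)
  then show ?thesis
    by (auto simp: mod_in_subset_sums_iff)
qed

text \<open>If a set \<open>T\<close> avoiding \<open>i\<close> had the same sum as
  \<open>I\<close>, then \<open>I - T\<close>, which contains \<open>i\<close>, would have sum 0
  modulo \<open>n\<close>. So every removal loses at least the total.\<close>

lemma total_notin_subset_sums_remove:
  assumes "finite I" "zsf_on n v I" "i \<in> I"
  shows "sum v I mod int n \<notin> subset_sums n v (I - {i})"
proof
  assume "sum v I mod int n \<in> subset_sums n v (I - {i})"
  then obtain T where T: "T \<subseteq> I - {i}" "[sum v I = sum v T] (mod int n)"
    by (auto simp: mod_in_subset_sums_iff)
  have "sum v (I - T) = sum v I - sum v T"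
    using T(1) assms(1) by (intro sum_diff) auto
  then have "int n dvd sum v (I - T)"
    using T(2) by (simp add: cong_iff_dvd_diff)
  moreover have "I - T \<noteq> {}" using T(1) assms(3) by auto
  ultimately show False using zsf_onD[OF assms(2), of "I - T"] by auto
qed

lemma total_in_subset_sums: "sum v I mod int n \<in> subset_sums n v I"
  by (auto simp: mod_in_subset_sums_iff)

lemma card_subset_sums_remove_less:
  assumes "finite I" "zsf_on n v I" "i \<in> I"
  shows "card (subset_sums n v (I - {i})) < card (subset_sums n v I)"
  using total_notin_subset_sums_remove[OF assms] total_in_subset_sums[of v I n]
    subset_sums_mono[of "I - {i}" I n v] finite_subset_sums[OF assms(1), of n v]
  by (intro psubset_card_mono) auto

lemma subset_sums_remove_eq:
  assumes "finite I" "zsf_on n v I" "i \<in> I"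
    and "card (subset_sums n v I) = Suc (card (subset_sums n v (I - {i})))"
  shows "subset_sums n v (I - {i}) = subset_sums n v I - {sum v I mod int n}"
proof (rule card_subset_eq)
  show "finite (subset_sums n v I - {sum v I mod int n})"
    using finite_subset_sums[OF assms(1)] by simp
  show "subset_sums n v (I - {i}) \<subseteq> subset_sums n v I - {sum v I mod int n}"
    using total_notin_subset_sums_remove[OF assms(1-3)] subset_sums_mono[of "I - {i}" I n v] by auto
  show "card (subset_sums n v (I - {i})) = card (subset_sums n v I - {sum v I mod int n})"
    using assms(4) total_in_subset_sums[of v I n] by simp
qed

text \<open>
  If both removals lose only the total sum \<open>\<sigma>\<close>, they leave the same set \<open>X\<close>, which is symmetric
  under \<open>z \<mapsto> \<sigma> - v i - z\<close> and \<open>z \<mapsto> \<sigma> - v j - z\<close>, hence invariant under translation by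
  \<open>h = v i - v j\<close>. If \<open>h \<noteq> 0\<close> then \<open>h\<close>, and so \<open>\<sigma> - h\<close>, lies in \<open>X\<close>, which forces \<open>\<sigma> \<in> X\<close>.
\<close>
lemma cong_if_removals_lose_one:
  assumes "finite I" "zsf_on n v I" "i \<in> I" "j \<in> I"
    and "card (subset_sums n v I) = Suc (card (subset_sums n v (I - {i})))"
    and "card (subset_sums n v I) = Suc (card (subset_sums n v (I - {j})))"
  shows "[v i = v j] (mod int n)"
proof (rule ccontr)
  assume neq: "\<not> [v i = v j] (mod int n)"
  define X where "X = subset_sums n v I - {sum v I mod int n}"
  have Xi: "X = subset_sums n v (I - {i})" and Xj: "X = subset_sums n v (I - {j})"
    using subset_sums_remove_eq[OF assms(1-3) assms(5)]
      subset_sums_remove_eq[OF assms(1,2,4) assms(6)] by (simp_all add: X_def)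
  have sums: "sum v (I - {i}) = sum v I - v i" "sum v (I - {j}) = sum v I - v j"
    using assms(1,3,4) by (simp_all add: sum_diff1)
  have inv: "(z + (v i - v j)) mod int n \<in> X" if "z mod int n \<in> X" for z
  proof -
    have "(sum v I - v i - z) mod int n \<in> X"
      using subset_sums_reflect[of "I - {i}" z n v] that assms(1) Xi sums by simp
    then have "(sum v I - v j - (sum v I - v i - z)) mod int n \<in> X"
      using subset_sums_reflect[of "I - {j}" "sum v I - v i - z" n v] assms(1) Xj sums by simp
    then show ?thesis by (simp add: algebra_simps)
  qed
  have "(v i - v j) mod int n \<in> X"
    using inv[of 0] zero_in_subset_sums[of n v "I - {i}"] Xi by simp
  then have "(sum v I - (v i - v j)) mod int n \<in> subset_sums n v I"
    using subset_sums_reflect[OF assms(1)] by (simp add: X_def)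
  \<comment> \<open>Here the incongruence of \<open>v i\<close> and \<open>v j\<close> enters: the
    reflected value differs from the one element left out of \<open>X\<close>.\<close>
  moreover have "(sum v I - (v i - v j)) mod int n \<noteq> sum v I mod int n"
  proof
    assume "(sum v I - (v i - v j)) mod int n = sum v I mod int n"
    then have "[sum v I - (v i - v j) = sum v I] (mod int n)" by (simp add: cong_def)
    then have "int n dvd v i - v j" by (simp add: cong_iff_dvd_diff dvd_diff_commute)
    with neq show False by (simp add: cong_iff_dvd_diff)
  qed
  ultimately have "(sum v I - (v i - v j)) mod int n \<in> X" by (simp add: X_def)
  from inv[OF this] show False by (simp add: X_def)
qed

section \<open>Adjoining an entry\<close>

lemma subset_sums_insert:
  assumes "finite I" "i \<notin> I"
  shows "subset_sums n v (insert i I) =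
    subset_sums n v I \<union> (\<lambda>z. (z + v i) mod int n) ` subset_sums n v I"
proof -
  have "(\<lambda>T. sum v T mod int n) ` insert i ` Pow I
      = (\<lambda>z. (z + v i) mod int n) ` subset_sums n v I"
    unfolding subset_sums_def image_image
  proof (rule image_cong)
    fix T assume "T \<in> Pow I"
    then have "i \<notin> T" "finite T" using assms finite_subset by auto
    then show "sum v (insert i T) mod int n = (sum v T mod int n + v i) mod int n"
      by (simp add: add.commute mod_simps)
  qed simp
  then show ?thesis
    by (simp add: subset_sums_def Pow_insert image_Un)
qed

text \<open>Otherwise a subset with sum \<open>z\<close>, enlarged by \<open>i\<close>, would have
  sum 0 modulo \<open>n\<close>.\<close>

lemma not_dvd_subset_sum_add:
  assumes "zsf_on n v (insert i I)" "finite I" "i \<notin> I" "z mod int n \<in> subset_sums n v I"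
  shows "\<not> int n dvd z + v i"
proof
  assume dvd: "int n dvd z + v i"
  obtain T where T: "T \<subseteq> I" "[z = sum v T] (mod int n)"
    using assms(4) by (auto simp: mod_in_subset_sums_iff)
  have "sum v (insert i T) = sum v T + v i"
    using T(1) assms(2,3) finite_subset by (subst sum.insert) auto
  moreover have "[z + v i = sum v T + v i] (mod int n)" using T(2) by (simp add: cong_add)
  ultimately have "int n dvd sum v (insert i T)" using dvd by (metis cong_dvd_iff)
  then show False using zsf_onD[OF assms(1), of "insert i T"] T(1) by auto
qed

lemma mod_subset_sums_insert_iff:
  assumes "finite I" "i \<notin> I"
  shows "z mod int n \<in> subset_sums n v (insert i I) \<longleftrightarrow>
    z mod int n \<in> subset_sums n v I \<or> (z - v i) mod int n \<in> subset_sums n v I"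
proof -
  have "z mod int n \<in> (\<lambda>w. (w + v i) mod int n) ` subset_sums n v I \<longleftrightarrow>
      (z - v i) mod int n \<in> subset_sums n v I"
  proof
    assume "z mod int n \<in> (\<lambda>w. (w + v i) mod int n) ` subset_sums n v I"
    then obtain w where w: "w \<in> subset_sums n v I" "z mod int n = (w + v i) mod int n" by auto
    then have "[z - v i = w + v i - v i] (mod int n)"
      unfolding cong_def[symmetric] by (intro cong_diff) (auto simp: cong_def)
    then have "(z - v i) mod int n = w mod int n" by (simp add: cong_def)
    then show "(z - v i) mod int n \<in> subset_sums n v I" using w(1) subset_sums_mod by metis
  next
    assume "(z - v i) mod int n \<in> subset_sums n v I"
    then show "z mod int n \<in> (\<lambda>w. (w + v i) mod int n) ` subset_sums n v I"
      by (rule rev_image_eqI) (simp add: mod_simps)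
  qed
  then show ?thesis by (simp add: subset_sums_insert[OF assms])
qed

section \<open>Families whose subset sums form a progression\<close>

text \<open>The last clause says that the additive order of \<open>b\<close> modulo \<open>n\<close>
  exceeds \<open>sum x I\<close>, so the listed terms of the progression are distinct.\<close>

definition progression_on :: "nat \<Rightarrow> ('i \<Rightarrow> int) \<Rightarrow> 'i set \<Rightarrow> int \<Rightarrow> ('i \<Rightarrow> nat) \<Rightarrow> bool" where
  "progression_on n v I b x \<longleftrightarrow>
     (\<forall>i\<in>I. 1 \<le> x i \<and> [v i = int (x i) * b] (mod int n)) \<and>
     subset_sums n v I = (\<lambda>j. (int j * b) mod int n) ` {..sum x I} \<and>
     (\<forall>j\<in>{1..sum x I}. \<not> int n dvd int j * b)"

lemma inj_on_multiples_mod: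
  assumes "\<forall>j\<in>{1..m}. \<not> int n dvd int j * b"
  shows "inj_on (\<lambda>j. (int j * b) mod int n) {..m}"
proof (rule linorder_inj_onI)
  fix i j assume ij: "i < j" "i \<in> {..m}" "j \<in> {..m}"
  have "j - i \<in> {1..m}" using ij by auto
  then have "\<not> int n dvd int (j - i) * b" using assms by blast
  then have "\<not> int n dvd int j * b - int i * b" using ij by (simp add: of_nat_diff algebra_simps)
  then show "(int i * b) mod int n \<noteq> (int j * b) mod int n"
    by (metis mod_eq_dvd_iff)
qed auto

lemma progression_on_card:
  assumes "progression_on n v I b x"
  shows "card (subset_sums n v I) = Suc (sum x I)"
  using inj_on_multiples_mod[of "sum x I" n b] assms
  by (simp add: progression_on_def card_image)

lemma progression_on_card_le:
  assumes "progression_on n v I b x"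
  shows "card I \<le> sum x I"
  using sum_mono[of I "\<lambda>_. 1" x] assms by (simp add: progression_on_def)

text \<open>Modulo \<open>n\<close> the sum over \<open>T\<close> depends only on
  \<open>card T\<close>, and every cardinality up to \<open>card I\<close> occurs.\<close>

lemma progression_on_const:
  assumes "finite I" "zsf_on n v I" "\<forall>i\<in>I. [v i = b] (mod int n)"
  shows "progression_on n v I b (\<lambda>_. 1)"
proof -
  have sum_cong: "[sum v T = int (card T) * b] (mod int n)" if "T \<subseteq> I" for T
    using cong_sum[of T v "\<lambda>_. b"] assms(3) that by (auto simp: subset_eq)
  have ex: "\<exists>T\<subseteq>I. card T = j" if "j \<le> card I" for j
    using obtain_subset_with_card_n[OF that] by metis
  have "subset_sums n v I = (\<lambda>j. (int j * b) mod int n) ` {..card I}"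
  proof (intro equalityI subsetI)
    fix z assume "z \<in> subset_sums n v I"
    then obtain T where T: "T \<subseteq> I" "z = sum v T mod int n" by (auto simp: subset_sums_def)
    then have "z = (int (card T) * b) mod int n" using sum_cong by (simp add: cong_def)
    moreover have "card T \<le> card I" using T assms(1) by (simp add: card_mono)
    ultimately show "z \<in> (\<lambda>j. (int j * b) mod int n) ` {..card I}" by auto
  next
    fix z assume "z \<in> (\<lambda>j. (int j * b) mod int n) ` {..card I}"
    then obtain j where j: "j \<le> card I" "z = (int j * b) mod int n" by auto
    then obtain T where T: "T \<subseteq> I" "card T = j" using ex by blast
    then have "z = sum v T mod int n" using j sum_cong[OF T(1)] by (simp add: cong_def)
    then show "z \<in> subset_sums n v I" using T by (auto simp: subset_sums_def)
  qed
  moreover have "\<not> int n dvd int j * b" if j: "1 \<le> j" "j \<le> card I" for j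
  proof -
    obtain T where T: "T \<subseteq> I" "card T = j" using ex j by blast
    then have "T \<noteq> {}" using j by auto
    then show ?thesis
      using zsf_onD[OF assms(2) T(1)] cong_dvd_iff[OF sum_cong[OF T(1)]] T by auto
  qed
  ultimately show ?thesis using assms(3) by (auto simp: progression_on_def)
qed

text \<open>
  Either \<open>v i\<close> is a small multiple of \<open>b\<close> and lengthens the progression, or it translates the
  progression off itself and doubles the number of subset sums.
\<close>
lemma progression_on_insert:
  assumes fin: "finite I" "i \<notin> I" and zsf: "zsf_on n v (insert i I)"
    and prog: "progression_on n v I b x"
    and card: "card (subset_sums n v (insert i I)) < 2 * Suc (sum x I)"
  shows "\<exists>x. progression_on n v (insert i I) b x"
proof -
  let ?S = "sum x I"
  have sub: "subset_sums n v I = (\<lambda>j. (int j * b) mod int n) ` {..?S}"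
    using prog by (simp add: progression_on_def)
  have mult_in: "(int j * b) mod int n \<in> subset_sums n v I" if "j \<le> ?S" for j
    using that sub by auto
  have nz: "\<not> int n dvd int j * b + v i" if "j \<le> ?S" for j
    using not_dvd_subset_sum_add[OF zsf fin mult_in[OF that]] .
  have "subset_sums n v I \<inter> (\<lambda>z. (z + v i) mod int n) ` subset_sums n v I \<noteq> {}"
  proof
    assume disj: "subset_sums n v I \<inter> (\<lambda>z. (z + v i) mod int n) ` subset_sums n v I = {}"
    have "inj_on (\<lambda>z. (z + v i) mod int n) (subset_sums n v I)"
    proof (rule inj_onI)
      fix z w assume zw: "z \<in> subset_sums n v I" "w \<in> subset_sums n v I"
        "(z + v i) mod int n = (w + v i) mod int n"
      then have "[z = w] (mod int n)" by (metis cong_add_rcancel cong_def)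
      then show "z = w" using zw subset_sums_mod by (metis cong_def)
    qed
    then have "card (subset_sums n v (insert i I)) = 2 * card (subset_sums n v I)"
      using disj fin by (simp add: subset_sums_insert card_Un_disjoint finite_subset_sums card_image)
    then show False using card progression_on_card[OF prog] by simp
  qed
  then obtain j k where jk: "j \<le> ?S" "k \<le> ?S"
    "(int k * b) mod int n = ((int j * b) mod int n + v i) mod int n"
    unfolding sub by auto
  then have c: "[int k * b = int j * b + v i] (mod int n)" by (simp add: cong_def mod_simps)
  \<comment> \<open>If \<open>k <= j\<close>, then \<open>j - k\<close> is at most \<open>?S\<close>
    and \<open>(j - k) * b + v i\<close> vanishes, contradicting \<open>nz\<close>.\<close>
  have "j < k"
  proof (rule ccontr)
    assume "\<not> j < k"
    then have "int (j - k) * b + v i = int j * b + v i - int k * b"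
      by (simp add: of_nat_diff algebra_simps)
    moreover have "int n dvd int j * b + v i - int k * b"
      using c by (simp add: cong_iff_dvd_diff dvd_diff_commute)
    ultimately have "int n dvd int (j - k) * b + v i" by metis
    then show False using nz[of "j - k"] jk by simp
  qed
  define t where "t = k - j"
  \<comment> \<open>The bound \<open>t <= ?S\<close> ensures that the progression and its translate
    by \<open>t\<close> leave no gap in \<open>{..?S + t}\<close>.\<close>
  have t: "1 \<le> t" "t \<le> ?S" using \<open>j < k\<close> jk by (auto simp: t_def)
  have "int t * b = int k * b - int j * b"
    using \<open>j < k\<close> by (simp add: t_def of_nat_diff algebra_simps)
  then have vt: "[v i = int t * b] (mod int n)"
    using cong_sym[OF cong_diff[OF c cong_refl[of "int j * b"]]] by simp
  define y where "y = x(i := t)"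
  have sumy: "sum y (insert i I) = ?S + t"
    using fin by (auto simp: y_def intro!: sum.cong)
  have shift: "[int m * b - v i = int (m - t) * b] (mod int n)" if "t \<le> m" for m
  proof -
    have "[int m * b - v i = int m * b - int t * b] (mod int n)"
      using vt by (intro cong_diff) auto
    then show ?thesis using that by (simp add: of_nat_diff algebra_simps)
  qed
  have "subset_sums n v (insert i I) = (\<lambda>j. (int j * b) mod int n) ` {..?S + t}"
  proof (intro equalityI subsetI)
    fix z assume z: "z \<in> subset_sums n v (insert i I)"
    show "z \<in> (\<lambda>j. (int j * b) mod int n) ` {..?S + t}"
    proof (cases "z \<in> subset_sums n v I")
      case True
      then show ?thesis unfolding sub by auto
    next
      case False
      then obtain m where m: "m \<le> ?S" "z = ((int m * b) mod int n + v i) mod int n"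
        using z fin unfolding subset_sums_insert[OF fin] sub by auto
      have "[int m * b + v i = int m * b + int t * b] (mod int n)" using vt by (intro cong_add) auto
      then have "z = (int (m + t) * b) mod int n"
        using m by (simp add: cong_def mod_simps algebra_simps)
      then show ?thesis using m by (intro image_eqI[of _ _ "m + t"]) auto
    qed
  next
    fix z assume "z \<in> (\<lambda>j. (int j * b) mod int n) ` {..?S + t}"
    then obtain m where m: "m \<le> ?S + t" "z = (int m * b) mod int n" by auto
    show "z \<in> subset_sums n v (insert i I)"
    proof (cases "m \<le> ?S")
      case True
      then show ?thesis using mult_in m subset_sums_insert[OF fin] by auto
    next
      case False
      then have "(int m * b - v i) mod int n \<in> subset_sums n v I"
        using shift[of m] mult_in[of "m - t"] m t by (simp add: cong_def)
      then show ?thesis using m mod_subset_sums_insert_iff[OF fin] by simp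
    qed
  qed
  moreover have "\<not> int n dvd int m * b" if m: "1 \<le> m" "m \<le> ?S + t" for m
  proof (cases "m \<le> ?S")
    case True
    then show ?thesis using prog m by (auto simp: progression_on_def)
  next
    case False
    \<comment> \<open>Beyond \<open>?S\<close>, the multiple \<open>m * b\<close> is the old subset
      sum \<open>(m - t) * b\<close> plus \<open>v i\<close>, so \<open>nz\<close> applies.\<close>
    then have tm: "t \<le> m" "m - t \<le> ?S" using m t by auto
    have "[int m * b - v i + v i = int (m - t) * b + v i] (mod int n)"
      using shift[OF tm(1)] by (intro cong_add) auto
    then show ?thesis using nz[OF tm(2)] cong_dvd_iff by fastforce
  qed
  ultimately have "progression_on n v (insert i I) b y"
    using prog t vt sumy fin by (auto simp: progression_on_def y_def)
  then show ?thesis by blast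
qed

text \<open>The structure theorem of Savchev and Chen, with a bound on the subset sums instead of on \<open>n\<close>.\<close>
lemma zsf_on_progression:
  assumes "finite I" "zsf_on n v I" "card (subset_sums n v I) < 2 * card I"
  shows "\<exists>b x. progression_on n v I b x"
  using assms
proof (induction "card I" arbitrary: I)
  case 0
  then show ?case by simp
next
  case (Suc m)
  show ?case
  proof (cases "\<forall>i\<in>I. card (subset_sums n v I) = Suc (card (subset_sums n v (I - {i})))")
    case True
    obtain k where k: "k \<in> I" using Suc.hyps(2) by (metis card.empty ex_in_conv nat.distinct(1))
    have "\<forall>i\<in>I. [v i = v k] (mod int n)"
      using True k cong_if_removals_lose_one[OF Suc.prems(1,2)] by blast
    then show ?thesis using progression_on_const[OF Suc.prems(1,2)] by blast
  next
    case False
    then obtain i where i: "i \<in> I"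
      "card (subset_sums n v I) \<noteq> Suc (card (subset_sums n v (I - {i})))" by blast
    let ?J = "I - {i}"
    have J: "finite ?J" "i \<notin> ?J" "insert i ?J = I" "m = card ?J" "zsf_on n v ?J"
      using Suc.prems Suc.hyps(2) i zsf_on_subset[of n v I "I - {i}"] by auto
    \<comment> \<open>Losing one sum is automatic, so here at least two are lost, which matches the
      drop by 2 of \<open>2 * card I\<close>.\<close>
    have "card (subset_sums n v ?J) + 2 \<le> card (subset_sums n v I)"
      using card_subset_sums_remove_less[OF Suc.prems(1,2) i(1)] i(2) by simp
    then have "card (subset_sums n v ?J) < 2 * card ?J"
      using Suc.prems(3) Suc.hyps(2) J(4) by linarith
    from Suc.hyps(1)[OF J(4,1,5) this] obtain b x where bx: "progression_on n v ?J b x" by blast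
    \<comment> \<open>All \<open>x i\<close> are at least 1, so \<open>2 * card I\<close> is at most
      twice the length of the progression: the sums cannot double.\<close>
    have "m \<le> sum x ?J" using progression_on_card_le[OF bx] J(4) by simp
    then have "card (subset_sums n v I) < 2 * Suc (sum x ?J)"
      using Suc.prems(3) by (simp flip: Suc.hyps(2))
    then show ?thesis
      using progression_on_insert[OF J(1,2) _ bx] J(3) Suc.prems(2) by metis
  qed
qed


section \<open>From the residue ring to integer sums\<close>

lemma finsum_residue_ring:
  assumes "n \<ge> 2" "finite I" "v \<in> I \<rightarrow> carrier (residue_ring (int n))"
  shows "finsum (residue_ring (int n)) v I = sum v I mod int n"
proof -
  interpret residues "int n" "residue_ring (int n)"
    using assms(1) by unfold_locales auto
  show ?thesis
    using assms(2,3)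
  proof (induction I rule: finite_induct)
    case empty
    then show ?case by (simp add: res_zero_eq)
  next
    case (insert i I)
    then show ?case by (simp add: res_add_eq mod_simps Pi_iff)
  qed
qed

lemma zero_sum_free_iff_zsf_on:
  assumes "n \<ge> 2" "v \<in> {1..d} \<rightarrow>\<^sub>E carrier (residue_ring (int n))"
  shows "zero_sum_free n d v \<longleftrightarrow> zsf_on n v {1..d}"
proof -
  interpret residues "int n" "residue_ring (int n)"
    using assms(1) by unfold_locales auto
  have "finsum (residue_ring (int n)) v T = sum v T mod int n" if "T \<subseteq> {1..d}" for T
    using that assms finite_subset[OF that] by (intro finsum_residue_ring) auto
  then have "finsum (residue_ring (int n)) v T = 0 \<longleftrightarrow> int n dvd sum v T" if "T \<subseteq> {1..d}" for T
    using that by (simp add: dvd_eq_mod_eq_0)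
  then show ?thesis
    unfolding zero_sum_free_def zsf_on_def res_zero_eq by blast
qed

section \<open>Positive tuples with sum below \<open>n\<close>\<close>

definition positive_tuples :: "nat \<Rightarrow> nat \<Rightarrow> (nat \<Rightarrow> nat) set" where
  "positive_tuples n d = {x \<in> {1..d} \<rightarrow>\<^sub>E {1..}. sum x {1..d} < n}"

lemma positive_tuples_card_le:
  assumes "x \<in> positive_tuples n d"
  shows "d \<le> sum x {1..d}"
  using sum_mono[of "{1..d}" "\<lambda>_. 1" x] assms by (auto simp: positive_tuples_def PiE_iff)

text \<open>The other \<open>d - 1\<close> entries take up at least \<open>d - 1\<close> of a total
  of at most \<open>n - 1\<close>. For \<open>n < 2 * d\<close> every entry is thus below
  \<open>n / 2\<close>, hence determined by its residue.\<close>

lemma positive_tuples_entry_le: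
  assumes "x \<in> positive_tuples n d" "i \<in> {1..d}"
  shows "x i + d \<le> n"
proof -
  have "card ({1..d} - {i}) \<le> sum x ({1..d} - {i})"
    using sum_mono[of "{1..d} - {i}" "\<lambda>_. 1" x] assms by (auto simp: positive_tuples_def PiE_iff)
  moreover have "sum x {1..d} = x i + sum x ({1..d} - {i})"
    using assms(2) by (simp add: sum.remove)
  moreover have "sum x {1..d} < n" using assms(1) by (simp add: positive_tuples_def)
  ultimately show ?thesis using assms(2) by auto
qed

text \<open>Entries all at least 2 would sum to at least \<open>2 * d > n\<close>. Where the entry
  is 1, the scaled vector shows its generator.\<close>

lemma positive_tuples_ex_one:
  assumes "x \<in> positive_tuples n d" "n < 2 * d"
  shows "\<exists>i\<in>{1..d}. x i = 1"
proof (rule ccontr)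
  assume no: "\<not> ?thesis"
  have "x i \<ge> 2" if "i \<in> {1..d}" for i
  proof -
    have "x i \<ge> 1" using assms(1) that by (auto simp: positive_tuples_def PiE_iff)
    moreover have "x i \<noteq> 1" using no that by blast
    ultimately show ?thesis by linarith
  qed
  then have "(\<Sum>i\<in>{1..d}. 2) \<le> sum x {1..d}" by (intro sum_mono) auto
  then show False using assms by (auto simp: positive_tuples_def)
qed

text \<open>Subtracting 1 from every entry and prepending the slack \<open>n - 1 - sum x {1..d}\<close>.\<close>
lemma card_positive_tuples:
  assumes "n \<ge> 1"
  shows "card (positive_tuples n d) = (n - 1) choose d"
proof (cases "d < n")
  case False
  then have "positive_tuples n d = {}"
    using positive_tuples_card_le[of _ n d] by (force simp: positive_tuples_def)
  then show ?thesis using False assms by (simp add: binomial_eq_0)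
next
  case True
  let ?L = "{l::nat list. length l = Suc d \<and> sum_list l = n - 1 - d}"
  define f where "f x = (n - 1 - sum x {1..d}) # map (\<lambda>i. x i - 1) [1..<Suc d]" for x :: "nat \<Rightarrow> nat"
  \<comment> \<open>Position 0 of the list holds the slack, so list and tuple agree in the indices
    \<open>1..d\<close>.\<close>
  define g where "g l = restrict (\<lambda>i. l ! i + 1) {1..d}" for l :: "nat list"
  have gsum: "sum (g l) {1..d} + l ! 0 = n - 1" if "l \<in> ?L" for l
  proof -
    have "sum (g l) {1..d} = (\<Sum>i=1..d. l ! i) + d"
      by (simp add: g_def sum_Suc)
    moreover have "sum_list l = l ! 0 + (\<Sum>i=1..d. l ! i)"
      using that by (simp add: sum_list_sum_nth atLeastLessThanSuc_atLeastAtMost sum.atLeast_Suc_atMost)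
    moreover have "sum_list l = n - 1 - d" using that by simp
    ultimately show ?thesis using True by linarith
  qed
  have "bij_betw f (positive_tuples n d) ?L"
  proof (rule bij_betw_byWitness[where f' = g])
    show "\<forall>x\<in>positive_tuples n d. g (f x) = x"
    proof
      fix x assume x: "x \<in> positive_tuples n d"
      show "g (f x) = x"
      proof
        fix i
        show "g (f x) i = x i"
        proof (cases "i \<in> {1..d}")
          case True
          then have "x i \<ge> 1" using x by (auto simp: positive_tuples_def PiE_iff)
          moreover obtain k where "i = Suc k" "k < d" using True by (cases i) auto
          ultimately show ?thesis by (simp add: g_def f_def del: upt_Suc)
        next
          case False
          then show ?thesis using x
            by (auto simp: g_def positive_tuples_def PiE_iff extensional_def)
        qed
      qed
    qed
    show "\<forall>l\<in>?L. f (g l) = l"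
    proof
      fix l assume l: "l \<in> ?L"
      show "f (g l) = l"
      proof (rule nth_equalityI)
        show "length (f (g l)) = length l" using l by (simp add: f_def)
        fix i assume "i < length (f (g l))"
        then have "i < Suc d" by (simp add: f_def del: upt_Suc)
        then show "f (g l) ! i = l ! i"
          using gsum[OF l] by (cases i) (auto simp: f_def g_def simp del: upt_Suc)
      qed
    qed
    show "f ` positive_tuples n d \<subseteq> ?L"
    proof safe
      fix x assume x: "x \<in> positive_tuples n d"
      show "length (f x) = Suc d" by (simp add: f_def del: upt_Suc)
      have "(\<Sum>i=1..d. x i - 1) = sum x {1..d} - d"
        using x by (subst sum_subtractf_nat) (auto simp: positive_tuples_def PiE_iff)
      moreover have "sum_list (map (\<lambda>i. x i - 1) [1..<Suc d]) = (\<Sum>i=1..d. x i - 1)"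
        by (simp add: sum_list_distinct_conv_sum_set atLeastLessThanSuc_atLeastAtMost del: upt_Suc)
      ultimately show "sum_list (f x) = n - 1 - d"
        using positive_tuples_card_le[OF x] x by (simp add: f_def positive_tuples_def del: upt_Suc)
    qed
    show "g ` ?L \<subseteq> positive_tuples n d"
    proof
      fix x assume "x \<in> g ` ?L"
      then obtain l where l: "l \<in> ?L" "x = g l" by blast
      then show "x \<in> positive_tuples n d"
        using gsum[OF l(1)] assms by (auto simp: positive_tuples_def g_def)
    qed
  qed
  then have "card (positive_tuples n d) = card ?L" by (rule bij_betw_same_card)
  \<comment> \<open>Stars and bars with \<open>d + 1\<close> parts.\<close>
  also have "\<dots> = (n - 1) choose (n - 1 - d)"
    using card_length_sum_list[of "Suc d" "n - 1 - d"] True by simp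
  also have "\<dots> = (n - 1) choose d"
    using True by (intro binomial_symmetric[symmetric]) simp
  finally show ?thesis .
qed

section \<open>Vectors as scaled positive tuples\<close>

text \<open>
  Let \<open>u\<close> be the value of \<open>y\<close> where \<open>x\<close> is 1, and \<open>w\<close> that of \<open>x\<close> where \<open>y\<close> is 1; then \<open>u w \<equiv> 1\<close>.
  Neither is 2, since both are at most \<open>n - d < n / 2\<close>; and if both are at least 3 then
  \<open>x i + y i \<ge> 4\<close> for every \<open>i\<close>, which makes the sums too large.
\<close>
lemma generator_unique:
  assumes nd: "n < 2 * d" "n > 1"
    and bc: "b \<in> totatives n" "c \<in> totatives n"
    and xy: "x \<in> positive_tuples n d" "y \<in> positive_tuples n d"
    and eq: "\<And>i. i \<in> {1..d} \<Longrightarrow> [b * x i = c * y i] (mod n)"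
  shows "b = c"
proof -
  have cop: "coprime b n" "coprime c n" and lt: "b < n" "c < n"
    using bc nd totatives_less by (auto simp: in_totatives_iff)
  obtain p where p: "p \<in> {1..d}" "x p = 1" using positive_tuples_ex_one[OF xy(1) nd(1)] by blast
  obtain q where q: "q \<in> {1..d}" "y q = 1" using positive_tuples_ex_one[OF xy(2) nd(1)] by blast
  define u w where "u = y p" and "w = x q"
  have b: "[b = c * u] (mod n)" using eq[OF p(1)] p(2) by (simp add: u_def)
  have c: "[b * w = c] (mod n)" using eq[OF q(1)] q(2) by (simp add: w_def)
  have small: "x i < n" "y i < n" if "i \<in> {1..d}" for i
    using positive_tuples_entry_le[OF xy(1) that] positive_tuples_entry_le[OF xy(2) that] nd
    by linarith+
  have pos: "x i \<ge> 1" "y i \<ge> 1" if "i \<in> {1..d}" for i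
    using xy that by (auto simp: positive_tuples_def PiE_iff)
  have yu: "y i = u" if i: "i \<in> {1..d}" "x i = 1" for i
  proof -
    have "[c * y i = c * u] (mod n)" using eq[OF i(1)] i(2) b by (metis cong_sym cong_trans mult.right_neutral)
    then have "[y i = u] (mod n)" using cop(2) by (simp add: cong_mult_lcancel_nat)
    then show ?thesis using small i p by (auto simp: cong_def u_def)
  qed
  have xw: "x i = w" if i: "i \<in> {1..d}" "y i = 1" for i
  proof -
    have "[b * x i = b * w] (mod n)" using eq[OF i(1)] i(2) c by (metis cong_sym cong_trans mult.right_neutral)
    then have "[x i = w] (mod n)" using cop(1) by (simp add: cong_mult_lcancel_nat)
    then show ?thesis using small i q by (auto simp: cong_def w_def)
  qed
  have "[c * (u * w) = c * 1] (mod n)"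
    using cong_trans[OF cong_sym[OF cong_mult[OF b cong_refl[of w]]] c] by (simp add: mult.assoc)
  then have uw: "[u * w = 1] (mod n)" using cop(2) by (subst (asm) cong_mult_lcancel_nat) auto
  have ub: "u + d \<le> n" "w + d \<le> n" "u \<ge> 1" "w \<ge> 1"
    using positive_tuples_entry_le[OF xy(2) p(1)] positive_tuples_entry_le[OF xy(1) q(1)] pos p q
    by (auto simp: u_def w_def)
  \<comment> \<open>From \<open>k <= n - d\<close> follows \<open>2 * k < n\<close>, so the
    congruence would be an equation. With \<open>uw\<close>, the case \<open>k = u\<close> excludes
    \<open>w = 2\<close> and vice versa.\<close>
  have no2: "\<not> [2 * k = 1] (mod n)" if "k + d \<le> n" for k
  proof
    assume "[2 * k = 1] (mod n)"
    then have "2 * k = 1" using that nd by (simp add: cong_def)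
    then show False by presburger
  qed
  have "u \<noteq> 2" "w \<noteq> 2" using no2[OF ub(1)] no2[OF ub(2)] uw by (auto simp: mult.commute)
  moreover have "\<not> (u \<ge> 3 \<and> w \<ge> 3)"
  proof
    assume uw3: "u \<ge> 3 \<and> w \<ge> 3"
    \<comment> \<open>Where one entry is 1 the other is \<open>u\<close> or \<open>w\<close>;
      elsewhere both are at least 2. Summing gives
      \<open>4 * d <= sum x + sum y < 2 * n\<close>.\<close>
    have "4 \<le> x i + y i" if i: "i \<in> {1..d}" for i
    proof (cases "x i = 1 \<or> y i = 1")
      case True
      then show ?thesis using pos[OF i] yu[OF i] xw[OF i] uw3 by linarith
    next
      case False
      then show ?thesis using pos[OF i] by linarith
    qed
    then have "(\<Sum>i\<in>{1..d}. 4) \<le> (\<Sum>i\<in>{1..d}. x i + y i)" by (intro sum_mono) auto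
    then show False using xy nd by (simp add: sum.distrib positive_tuples_def)
  qed
  ultimately have "u = 1 \<or> w = 1" using ub by linarith
  then have "[b = c] (mod n)" using b c by auto
  then show "b = c" using lt by (simp add: cong_def)
qed

definition scaled_tuple :: "nat \<Rightarrow> nat \<Rightarrow> nat \<times> (nat \<Rightarrow> nat) \<Rightarrow> nat \<Rightarrow> int" where
  "scaled_tuple n d = (\<lambda>(b, x). restrict (\<lambda>i. int (b * x i mod n)) {1..d})"

text \<open>Once the generators agree, the unit cancels and entries below \<open>n\<close> are
  equal.\<close>

lemma inj_on_scaled_tuple:
  assumes "n < 2 * d" "n > 1"
  shows "inj_on (scaled_tuple n d) (totatives n \<times> positive_tuples n d)"
proof (rule inj_onI, clarify)
  fix b c x y
  assume *: "b \<in> totatives n" "c \<in> totatives n" "x \<in> positive_tuples n d" "y \<in> positive_tuples n d"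
    "scaled_tuple n d (b, x) = scaled_tuple n d (c, y)"
  have eq: "[b * x i = c * y i] (mod n)" if "i \<in> {1..d}" for i
    using fun_cong[OF *(5), of i] that by (simp add: scaled_tuple_def cong_def)
  then have bc: "b = c" using generator_unique assms * by blast
  have "x = y"
  proof
    fix i
    show "x i = y i"
    proof (cases "i \<in> {1..d}")
      case True
      have "[x i = y i] (mod n)"
        using eq[OF True] bc *(1) by (simp add: cong_mult_lcancel_nat in_totatives_iff)
      moreover have "x i < n" "y i < n"
        using positive_tuples_entry_le[OF *(3) True] positive_tuples_entry_le[OF *(4) True] assms
        by linarith+
      ultimately show ?thesis by (simp add: cong_def)
    next
      case False
      then show ?thesis using *(3,4) by (auto simp: positive_tuples_def PiE_iff extensional_def)
    qed
  qed
  with bc show "b = c \<and> x = y" by simp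
qed

text \<open>Partial sums of \<open>x\<close> lie strictly between 0 and \<open>n\<close>, and
  multiplying by a unit preserves not being divisible by \<open>n\<close>.\<close>

lemma scaled_tuple_in_zero_sum_free_vectors:
  assumes "n \<ge> 2" "b \<in> totatives n" "x \<in> positive_tuples n d"
  shows "scaled_tuple n d (b, x) \<in> zero_sum_free_vectors n d"
proof -
  let ?v = "scaled_tuple n d (b, x)"
  interpret residues "int n" "residue_ring (int n)"
    using assms(1) by unfold_locales auto
  have "b * x i mod n < n" for i using assms(1) by simp
  then have car: "?v \<in> {1..d} \<rightarrow>\<^sub>E carrier (residue_ring (int n))"
    by (auto simp: scaled_tuple_def res_carrier_eq zle_diff1_eq simp del: of_nat_mod)
  have "zsf_on n ?v {1..d}"
    unfolding zsf_on_def
  proof (intro allI impI notI)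
    fix T assume T: "T \<subseteq> {1..d}" "T \<noteq> {}" and dvd: "int n dvd sum ?v T"
    have "sum ?v T = int (\<Sum>i\<in>T. b * x i mod n)"
      using T(1) by (auto simp: scaled_tuple_def intro!: sum.cong)
    then have "n dvd (\<Sum>i\<in>T. b * x i mod n)" using dvd by (metis of_nat_dvd_iff)
    then have "n dvd (\<Sum>i\<in>T. b * x i)" by (simp add: dvd_eq_mod_eq_0 mod_sum_eq)
    then have "n dvd b * sum x T" by (simp add: sum_distrib_left)
    then have "n dvd sum x T"
      using assms(2) by (simp add: in_totatives_iff coprime_commute coprime_dvd_mult_right_iff)
    moreover have "sum x T \<le> sum x {1..d}" using T(1) by (intro sum_mono2) auto
    moreover have "sum x T > 0"
    proof -
      obtain i where i: "i \<in> T" using T(2) by blast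
      have "x i \<le> sum x T" using i T(1) finite_subset by (intro member_le_sum) auto
      moreover have "x i \<ge> 1" using i T(1) assms(3) by (auto simp: positive_tuples_def PiE_iff)
      ultimately show ?thesis by linarith
    qed
    ultimately have "n \<le> sum x {1..d}" using dvd_imp_le by (metis order_trans)
    then show False using assms(3) by (simp add: positive_tuples_def)
  qed
  then show ?thesis
    using car zero_sum_free_iff_zsf_on[OF assms(1) car] by (simp add: zero_sum_free_vectors_def)
qed

text \<open>There are at most \<open>n < 2 * d\<close> subset sums, so the structure theorem
  applies; it remains to see that the generator is a unit.\<close>

lemma zero_sum_free_vector_scaled:
  assumes n: "n \<ge> 2" "n < 2 * d" and v: "v \<in> zero_sum_free_vectors n d"
  shows "v \<in> scaled_tuple n d ` (totatives n \<times> positive_tuples n d)"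
proof -
  interpret residues "int n" "residue_ring (int n)"
    using n(1) by unfold_locales auto
  have car: "v \<in> {1..d} \<rightarrow>\<^sub>E carrier (residue_ring (int n))"
    using v by (simp add: zero_sum_free_vectors_def)
  have zsf: "zsf_on n v {1..d}"
    using v zero_sum_free_iff_zsf_on[OF n(1) car] by (simp add: zero_sum_free_vectors_def)
  have "subset_sums n v {1..d} \<subseteq> {0..<int n}" using n(1) by (auto simp: subset_sums_def)
  then have card: "card (subset_sums n v {1..d}) \<le> n"
    using card_mono[of "{0..<int n}"] by fastforce
  obtain b x where bx: "progression_on n v {1..d} b x"
    using zsf_on_progression[OF _ zsf] card n(2) by fastforce
  let ?S = "sum x {1..d}"
  have S: "d \<le> ?S" "?S < n"
    using progression_on_card_le[OF bx] progression_on_card[OF bx] card by auto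
  have nz: "\<not> int n dvd int j * b" if "1 \<le> j" "j \<le> ?S" for j
    using bx that by (auto simp: progression_on_def)
  define c where "c = nat (b mod int n)"
  have c: "int c = b mod int n" using n(1) by (simp add: c_def)
  have "coprime b (int n)"
  proof (rule ccontr)
    assume "\<not> coprime b (int n)"
    \<comment> \<open>A common divisor \<open>h >= 2\<close> would make \<open>m = n / h\<close> at
      most \<open>n / 2 < d <= ?S\<close>, yet \<open>m * b\<close> vanishes modulo
      \<open>n\<close>.\<close>
    define h where "h = nat (gcd b (int n))"
    have h: "int h = gcd b (int n)" by (simp add: h_def)
    then have "h \<noteq> 1" using \<open>\<not> coprime b (int n)\<close> by (auto simp: coprime_iff_gcd_eq_1)
    have "int h dvd int n" "int h dvd b" unfolding h by auto
    then obtain m k where m: "n = h * m" and k: "b = int h * k" by (auto elim!: dvdE)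
    have "h \<noteq> 0" "m \<noteq> 0" using m n(1) by (auto intro: Nat.gr0I)
    then have "2 \<le> h" using \<open>h \<noteq> 1\<close> by linarith
    then have "2 * m \<le> n" unfolding m by (rule mult_right_mono) simp
    then have "\<not> int n dvd int m * b" using nz[of m] \<open>m \<noteq> 0\<close> S n(2) by auto
    moreover have "int m * b = int n * k" by (simp add: m k)
    ultimately show False by simp
  qed
  then have "coprime (int c) (int n)" unfolding c using n(1) by (simp add: coprime_mod_left_iff)
  then have cop: "coprime c n" by simp
  have "c > 0" using cop n(1) by (intro Nat.gr0I) auto
  moreover have "int c < int n" unfolding c using n(1) by simp
  ultimately have ctot: "c \<in> totatives n" using cop by (simp add: in_totatives_iff)
  \<comment> \<open>\<open>progression_on\<close> leaves \<open>x\<close> arbitrary outside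
    \<open>{1..d}\<close>.\<close>
  define y where "y = restrict x {1..d}"
  have "sum y {1..d} = ?S" by (auto simp: y_def)
  then have y: "y \<in> positive_tuples n d"
    using bx S by (auto simp: positive_tuples_def y_def progression_on_def)
  have "v = scaled_tuple n d (c, y)"
  proof
    fix i
    show "v i = scaled_tuple n d (c, y) i"
    proof (cases "i \<in> {1..d}")
      case True
      have "v i = v i mod int n" using True car n(1) by (auto simp: PiE_iff res_carrier_eq)
      also have "\<dots> = (int (x i) * b) mod int n"
        using bx True by (auto simp: progression_on_def cong_def)
      also have "\<dots> = (int c * int (x i)) mod int n" unfolding c by (simp add: mod_simps mult.commute)
      finally show ?thesis using True by (simp add: scaled_tuple_def y_def zmod_int)
    next
      case False
      then show ?thesis using car by (auto simp: scaled_tuple_def PiE_iff extensional_def)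
    qed
  qed
  then show ?thesis using ctot y by blast
qed

theorem theorem2p5:
  fixes n d :: nat
  assumes "n \<ge> 3" and "real d > real n / 2"
  shows "zsf_count n d = totient n * ((n - 1) choose d)"
proof -
  have nd: "n < 2 * d" "n > 1" "n \<ge> 2" "n \<ge> 1" using assms by linarith+
  have "zero_sum_free_vectors n d = scaled_tuple n d ` (totatives n \<times> positive_tuples n d)"
    using scaled_tuple_in_zero_sum_free_vectors[OF nd(3)] zero_sum_free_vector_scaled[OF nd(3,1)]
    by auto
  then have "zsf_count n d = card (totatives n \<times> positive_tuples n d)"
    unfolding zsf_count_def by (simp add: card_image inj_on_scaled_tuple[OF nd(1,2)])
  then show ?thesis
    by (simp add: card_cartesian_product card_positive_tuples[OF nd(4)] totient_def)
qed

end
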